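(* Let $N\ge2$, let $Y_1,\dots,Y_N\in\mathbb{P}_n$, and let $(X^\star,t^\star)$ be a solution to the problem $$\min_{X\succ0,\ t\in\mathbb{R}}\ t\quad\text{subject to}\quad e^{-t}Y_i\preceq X\preceq e^{t}Y_i\ \text{ for all } i=1,\dots,N.$$ Then there exist distinct $i^\star,j^\star\in\{1,\dots,N\}$ such that $$\log\left(\lambda_{\max}\left(Y_{i^\star}^{-1/2}X^\star Y_{i^\star}^{-1/2}\right)\right)=-\log\left(\lambda_{\min}\left(Y_{j^\star}^{-1/2}X^\star Y_{j^\star}^{-1/2}\right)\right)=t^\star.$$
   Context: $\mathbb{P}_n$ is the set of $n\times n$ complex Hermitian positive definite matrices; $X\succ0$ means $X\in\mathbb{P}_n$; $X\preceq Y$ means $Y-X$ is positive semidefinite. $\lambda_{\max}$ and $\lambda_{\min}$ denote the largest and smallest eigenvalues. *)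

theory Defs
  imports
    Complex_Main
    "Jordan_Normal_Form.Schur_Decomposition"
    "Jordan_Normal_Form.Gauss_Jordan_Elimination"
begin

definition hermitian_mat :: "complex mat \<Rightarrow> bool" where
  "hermitian_mat A \<longleftrightarrow> mat_adjoint A = A"

text \<open>The scalar product \<open>x \<bullet>c y\<close> is conjugate-linear in its second argument, so that
  \<open>(A *\<^sub>v v) \<bullet>c v\<close> is the Hermitian form \<open>v\<^sup>* A v\<close>, which is real for Hermitian \<open>A\<close>.\<close>

definition pos_semidef_mats :: "nat \<Rightarrow> complex mat set" where
  "pos_semidef_mats n = {A \<in> carrier_mat n n. hermitian_mat A \<and>
     (\<forall>v \<in> carrier_vec n. Re ((A *\<^sub>v v) \<bullet>c v) \<ge> 0)}"

definition pos_def_mats :: "nat \<Rightarrow> complex mat set" where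
  "pos_def_mats n = {A \<in> carrier_mat n n. hermitian_mat A \<and>
     (\<forall>v \<in> carrier_vec n. v \<noteq> 0\<^sub>v n \<longrightarrow> Re ((A *\<^sub>v v) \<bullet>c v) > 0)}"

definition loewner_le :: "nat \<Rightarrow> complex mat \<Rightarrow> complex mat \<Rightarrow> bool" where
  "loewner_le n X Y \<longleftrightarrow> Y - X \<in> pos_semidef_mats n"

definition psd_sqrt :: "complex mat \<Rightarrow> complex mat" where
  "psd_sqrt A = (THE S. S \<in> pos_semidef_mats (dim_row A) \<and> S * S = A)"

text \<open>\<open>A\<^sup>-\<^sup>1\<^sup>/\<^sup>2\<close>, meaningful for invertible positive semidefinite \<open>A\<close>; for invertible \<open>A\<close>,
  \<open>mat_inverse A\<close> is \<open>Some\<close> of the inverse matrix.\<close>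

definition inv_sqrt :: "complex mat \<Rightarrow> complex mat" where
  "inv_sqrt A = psd_sqrt (the (mat_inverse A))"

text \<open>Extreme eigenvalues of a Hermitian matrix of positive dimension, all of whose
  eigenvalues are real.\<close>

definition lambda_max :: "complex mat \<Rightarrow> real" where
  "lambda_max A = Max {r :: real. eigenvalue A (complex_of_real r)}"

definition lambda_min :: "complex mat \<Rightarrow> real" where
  "lambda_min A = Min {r :: real. eigenvalue A (complex_of_real r)}"

definition feasible :: "nat \<Rightarrow> nat \<Rightarrow> (nat \<Rightarrow> complex mat) \<Rightarrow> complex mat \<times> real \<Rightarrow> bool" where
  "feasible n N Y = (\<lambda>(X, t). X \<in> pos_def_mats n \<and>
     (\<forall>i \<in> {1..N}. loewner_le n (complex_of_real (exp (- t)) \<cdot>\<^sub>m Y i) X \<and>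
                   loewner_le n X (complex_of_real (exp t) \<cdot>\<^sub>m Y i)))"

definition is_solution :: "nat \<Rightarrow> nat \<Rightarrow> (nat \<Rightarrow> complex mat) \<Rightarrow> complex mat \<times> real \<Rightarrow> bool" where
  "is_solution n N Y = is_arg_min (\<lambda>(X, t). t) (feasible n N Y)"

end

theory Submission
  imports Defs "Jordan_Normal_Form.Spectral_Radius"
begin

text \<open>Put \<open>M\<^sub>i = Y\<^sub>i\<^sup>-\<^sup>1\<^sup>/\<^sup>2 X Y\<^sub>i\<^sup>-\<^sup>1\<^sup>/\<^sup>2\<close>. The constraints say that the spectra of all \<open>M\<^sub>i\<close> lie in
  \<open>[e\<^sup>-\<^sup>t, e\<^sup>t]\<close>. If no \<open>M\<^sub>i\<close> attains the upper (lower) end, scaling \<open>X\<close> up (down) slightly makes all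
  constraints strict, so \<open>t\<close> can be decreased. The remaining way for the claim to fail is that a
  single index \<open>k\<close> attains both ends and no other index attains either; if \<open>t > 0\<close>, then moving \<open>X\<close>
  slightly along the segment towards \<open>Y\<^sub>k\<close> again makes all constraints strict. If \<open>t \<le> 0\<close>, every
  index attains both ends and any two distinct indices will do.\<close>

section \<open>Adjoints and Hermitian forms\<close>

lemma mat_adjoint_carrier [simp, intro]:
  "A \<in> carrier_mat n m \<Longrightarrow> mat_adjoint A \<in> carrier_mat m n"
  by (auto simp: mat_adjoint_def)

lemma dim_mat_adjoint [simp]:
  "dim_row (mat_adjoint A) = dim_col A" "dim_col (mat_adjoint A) = dim_row A"
  by (auto simp: mat_adjoint_def)

lemma index_mat_adjoint [simp]:
  "i < dim_col A \<Longrightarrow> j < dim_row A \<Longrightarrow> mat_adjoint A $$ (i, j) = conjugate (A $$ (j, i))"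
  by (simp add: mat_adjoint_def mat_of_rows_index)

lemma mat_adjoint_adjoint [simp]: "mat_adjoint (mat_adjoint A) = A"
  by (rule eq_matI) auto

lemma mat_adjoint_mult:
  fixes A B :: "complex mat"
  assumes "A \<in> carrier_mat n m" "B \<in> carrier_mat m k"
  shows "mat_adjoint (A * B) = mat_adjoint B * mat_adjoint A"
  using assms by (intro eq_matI) (auto simp: scalar_prod_def mult.commute)

lemma mat_adjoint_add:
  fixes A B :: "complex mat"
  assumes "A \<in> carrier_mat n m" "B \<in> carrier_mat n m"
  shows "mat_adjoint (A + B) = mat_adjoint A + mat_adjoint B"
  using assms by (intro eq_matI) auto

lemma mat_adjoint_minus:
  fixes A B :: "complex mat"
  assumes "A \<in> carrier_mat n m" "B \<in> carrier_mat n m"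
  shows "mat_adjoint (A - B) = mat_adjoint A - mat_adjoint B"
  using assms by (intro eq_matI) auto

lemma mat_adjoint_smult:
  "mat_adjoint (c \<cdot>\<^sub>m A) = cnj c \<cdot>\<^sub>m mat_adjoint A"
  by (intro eq_matI) auto

lemma mat_adjoint_one [simp]: "mat_adjoint (1\<^sub>m n :: complex mat) = 1\<^sub>m n"
  by (intro eq_matI) auto

lemma mat_adjoint_mat_diag:
  "mat_adjoint (mat_diag n f :: complex mat) = mat_diag n (\<lambda>i. cnj (f i))"
  by (intro eq_matI) (auto simp: mat_diag_def)

section \<open>The complex inner product and Hermitian forms\<close>

lemma cscalar_prod_eq_sum:
  fixes v w :: "complex vec"
  assumes "w \<in> carrier_vec n"
  shows "v \<bullet>c w = (\<Sum>i<n. v $ i * cnj (w $ i))"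
  using assms by (simp add: scalar_prod_def lessThan_atLeast0)

lemma cscalar_prod_self:
  fixes v :: "complex vec"
  assumes "v \<in> carrier_vec n"
  shows "v \<bullet>c v = complex_of_real (\<Sum>i<n. (cmod (v $ i))\<^sup>2)"
  using assms
  by (simp add: cscalar_prod_eq_sum complex_norm_square del: of_real_power)

lemma cscalar_prod_mult_mat_vec:
  fixes A :: "complex mat"
  assumes A: "A \<in> carrier_mat n m" and v: "v \<in> carrier_vec m" and w: "w \<in> carrier_vec n"
  shows "(A *\<^sub>v v) \<bullet>c w = v \<bullet>c (mat_adjoint A *\<^sub>v w)"
proof -
  have "(A *\<^sub>v v) \<bullet>c w = (\<Sum>i<n. \<Sum>j<m. A $$ (i, j) * v $ j * cnj (w $ i))"
    using A v w
    by (simp add: cscalar_prod_eq_sum[OF w] scalar_prod_def lessThan_atLeast0 sum_distrib_right)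
  also have "\<dots> = (\<Sum>j<m. \<Sum>i<n. A $$ (i, j) * v $ j * cnj (w $ i))"
    by (rule sum.swap)
  also have "\<dots> = v \<bullet>c (mat_adjoint A *\<^sub>v w)"
    using A v w
    by (simp add: cscalar_prod_eq_sum[of _ m] scalar_prod_def lessThan_atLeast0 sum_distrib_left
        mult_ac)
  finally show ?thesis .
qed

lemma cscalar_prod_commute:
  fixes v w :: "complex vec"
  assumes "v \<in> carrier_vec n" "w \<in> carrier_vec n"
  shows "w \<bullet>c v = cnj (v \<bullet>c w)"
  using assms by (simp add: cscalar_prod_eq_sum mult.commute)

abbreviation herm_form :: "complex mat \<Rightarrow> complex vec \<Rightarrow> real" where
  "herm_form A v \<equiv> Re ((A *\<^sub>v v) \<bullet>c v)"

lemma herm_form_add: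
  assumes "A \<in> carrier_mat n n" "B \<in> carrier_mat n n" "v \<in> carrier_vec n"
  shows "herm_form (A + B) v = herm_form A v + herm_form B v"
  using assms by (simp add: add_mult_distrib_mat_vec[of _ n n] add_scalar_prod_distrib[of _ n])

lemma herm_form_minus:
  assumes "A \<in> carrier_mat n n" "B \<in> carrier_mat n n" "v \<in> carrier_vec n"
  shows "herm_form (A - B) v = herm_form A v - herm_form B v"
  using assms by (simp add: minus_mult_distrib_mat_vec[of _ n n] minus_scalar_prod_distrib[of _ n])

lemma herm_form_smult:
  assumes "A \<in> carrier_mat n n" "v \<in> carrier_vec n"
  shows "herm_form (complex_of_real c \<cdot>\<^sub>m A) v = c * herm_form A v"
proof -
  have "(complex_of_real c \<cdot>\<^sub>m A) *\<^sub>v v = complex_of_real c \<cdot>\<^sub>v (A *\<^sub>v v)"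
    using assms by (intro eq_vecI) (auto simp: scalar_prod_def sum_distrib_left mult_ac)
  then show ?thesis using assms by simp
qed

text \<open>This is the change of variables \<open>v\<close> to \<open>S *\<^sub>v v\<close>. It
  serves twice: with the adjoint of a unitary \<open>U\<close> to diagonalise a form, and with
  \<open>S = inv_sqrt Y\<close> to remove inverse square roots from the constraints.\<close>

lemma herm_form_congruence:
  assumes A: "A \<in> carrier_mat n n" and S: "S \<in> carrier_mat n n" and v: "v \<in> carrier_vec n"
  shows "herm_form (mat_adjoint S * A * S) v = herm_form A (S *\<^sub>v v)"
proof -
  have "(mat_adjoint S * A * S) *\<^sub>v v = mat_adjoint S *\<^sub>v (A *\<^sub>v (S *\<^sub>v v))"
    using assms by (simp add: assoc_mult_mat_vec[of _ n n _ n] mult_carrier_mat[of _ n n _ n])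
  moreover have "(mat_adjoint S *\<^sub>v (A *\<^sub>v (S *\<^sub>v v))) \<bullet>c v = (A *\<^sub>v (S *\<^sub>v v)) \<bullet>c (S *\<^sub>v v)"
    using cscalar_prod_mult_mat_vec[of "mat_adjoint S" n n "A *\<^sub>v (S *\<^sub>v v)" v] assms by simp
  ultimately show ?thesis by simp
qed

text \<open>Extend \<open>v\<close> to a basis, orthogonalise, and normalise. Gram-Schmidt leaves
  the first vector unchanged, so only the normalising factor \<open>c\<close> separates the first
  column from \<open>v\<close>.\<close>

lemma unitary_completion:
  fixes v :: "complex vec"
  assumes v: "v \<in> carrier_vec n" and v0: "v \<noteq> 0\<^sub>v n"
  shows "\<exists>W c. W \<in> carrier_mat n n \<and> mat_adjoint W * W = 1\<^sub>m n \<and> col W 0 = c \<cdot>\<^sub>v v"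
proof -
  interpret cof_vec_space n "TYPE(complex)" .
  define b where "b = basis_completion v"
  define ws where "ws = gram_schmidt n b"
  from basis_completion[OF v v0, folded b_def]
  have dist_b: "distinct b" and indep: "\<not> lin_dep (set b)" and b: "set b \<subseteq> carrier_vec n"
    and hdb: "hd b = v" and len_b: "length b = n" by auto
  have n: "n \<noteq> 0" using v v0 by auto
  from hdb len_b n obtain vs where bv: "b = v # vs" by (cases b, auto)
  from gram_schmidt_result[OF b dist_b indep refl, folded ws_def]
  have ws: "set ws \<subseteq> carrier_vec n" and orth: "corthogonal ws" and len: "length ws = n"
    by (auto simp: len_b)
  from gram_schmidt_hd[OF v, of vs, folded bv] have hdws: "hd ws = v" unfolding ws_def .
  \<comment> \<open>The vectors \<open>ws\<close> are orthogonal but not of unit length;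
    \<open>r i\<close> is the norm of the \<open>i\<close>-th one and \<open>u i\<close> the
    normalised vector.\<close>
  define r where "r i = sqrt (\<Sum>k<n. (cmod (ws ! i $ k))\<^sup>2)" for i
  define u where "u i = complex_of_real (1 / r i) \<cdot>\<^sub>v ws ! i" for i
  have wsc: "ws ! i \<in> carrier_vec n" if "i < n" for i using ws len that by auto
  have self: "ws ! i \<bullet>c ws ! i = complex_of_real ((r i)\<^sup>2)" if "i < n" for i
    unfolding cscalar_prod_self[OF wsc[OF that]] r_def by (simp add: sum_nonneg)
  \<comment> \<open>\<open>corthogonal\<close> also demands that each vector has a nonzero product
    with itself, so dividing by \<open>r i\<close> is legitimate.\<close>
  have r0: "r i \<noteq> 0" if "i < n" for i
    using corthogonalD[OF orth, of i i] len that self[OF that] by auto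
  define W where "W = mat_of_cols n (map u [0..<n])"
  have uc: "u i \<in> carrier_vec n" if "i < n" for i using wsc[OF that] by (simp add: u_def)
  have W: "W \<in> carrier_mat n n" unfolding W_def by auto
  have colW: "col W i = u i" if "i < n" for i
    using that uc unfolding W_def by simp
  have ip: "u j \<bullet>c u i = (if i = j then 1 else 0)" if i: "i < n" and j: "j < n" for i j
  proof -
    have "u j \<bullet>c u i = complex_of_real (1 / r j) * complex_of_real (1 / r i) * (ws ! j \<bullet>c ws ! i)"
      unfolding u_def using wsc[OF i] wsc[OF j] by (simp add: conjugate_smult_vec)
    then show ?thesis
      using corthogonalD[OF orth, of j i] i j len self[OF i] r0[OF i]
      by (auto simp: power2_eq_square)
  qed
  have "mat_adjoint W * W = 1\<^sub>m n"
  proof (rule eq_matI)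
    fix i j assume ij: "i < dim_row (1\<^sub>m n :: complex mat)" "j < dim_col (1\<^sub>m n :: complex mat)"
    have "(mat_adjoint W * W) $$ (i, j) = (\<Sum>k<n. cnj (col W i $ k) * col W j $ k)"
      using ij W by (simp add: scalar_prod_def lessThan_atLeast0)
    also have "\<dots> = u j \<bullet>c u i"
      using ij colW uc by (simp add: cscalar_prod_eq_sum[of _ n] mult.commute)
    finally show "(mat_adjoint W * W) $$ (i, j) = 1\<^sub>m n $$ (i, j)" using ij ip by simp
  qed (use W in auto)
  moreover have "ws ! 0 = v" using hdws len n by (cases ws) auto
  ultimately show ?thesis using W colW[of 0] n unfolding u_def by auto
qed

section \<open>The spectral theorem for Hermitian matrices\<close>

lemma unitary_mult:
  fixes U V :: "complex mat"
  assumes U: "U \<in> carrier_mat n n" "mat_adjoint U * U = 1\<^sub>m n"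
    and V: "V \<in> carrier_mat n n" "mat_adjoint V * V = 1\<^sub>m n"
  shows "mat_adjoint (U * V) * (U * V) = 1\<^sub>m n"
proof -
  have "mat_adjoint (U * V) * (U * V) = mat_adjoint V * ((mat_adjoint U * U) * V)"
    using U(1) V(1)
    by (simp add: mat_adjoint_mult assoc_mult_mat[of _ n n _ n _ n] mult_carrier_mat[of _ n n _ n])
  then show ?thesis using U V by simp
qed

lemma mat_adjoint_four_block_diag:
  fixes A D :: "complex mat"
  assumes "A \<in> carrier_mat k k" "D \<in> carrier_mat m m"
  shows "mat_adjoint (four_block_mat A (0\<^sub>m k m) (0\<^sub>m m k) D)
    = four_block_mat (mat_adjoint A) (0\<^sub>m k m) (0\<^sub>m m k) (mat_adjoint D)"
  using assms by (intro eq_matI) auto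

lemma mult_four_block_diag:
  fixes A D A' D' :: "complex mat"
  assumes "A \<in> carrier_mat k k" "D \<in> carrier_mat m m" "A' \<in> carrier_mat k k" "D' \<in> carrier_mat m m"
  shows "four_block_mat A (0\<^sub>m k m) (0\<^sub>m m k) D * four_block_mat A' (0\<^sub>m k m) (0\<^sub>m m k) D'
    = four_block_mat (A * A') (0\<^sub>m k m) (0\<^sub>m m k) (D * D')"
  using assms by (subst mult_four_block_mat[of _ k k _ m _ m _ _ k _ m]) auto

text \<open>Induction on the dimension by deflation: a unitary \<open>W\<close> whose first column
  is an eigenvector turns \<open>A\<close> into a block diagonal matrix with a scalar block and a
  smaller Hermitian block. The values \<open>d\<close> are still complex here; their reality follows
  in \<open>hermitian_spectral_theorem\<close>.\<close>

lemma hermitian_diagonalizable: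
  assumes "A \<in> carrier_mat n n" and "hermitian_mat A"
  shows "\<exists>U d. U \<in> carrier_mat n n \<and> mat_adjoint U * U = 1\<^sub>m n \<and> A * U = U * mat_diag n d"
  using assms
proof (induction n arbitrary: A)
  case 0
  then show ?case by (intro exI[of _ "1\<^sub>m 0"] exI[of _ undefined]) (auto simp: mat_diag_def mat_eq_iff)
next
  case (Suc m)
  let ?n = "Suc m"
  note A = Suc.prems(1)
  obtain e where "eigenvalue A e"
    using spectrum_non_empty[OF A] unfolding spectrum_def by auto
  then obtain v where v: "v \<in> carrier_vec ?n" "v \<noteq> 0\<^sub>v ?n" "A *\<^sub>v v = e \<cdot>\<^sub>v v"
    using A unfolding eigenvalue_def eigenvector_def by auto
  obtain W c where W: "W \<in> carrier_mat ?n ?n" and WW: "mat_adjoint W * W = 1\<^sub>m ?n"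
    and W0: "col W 0 = c \<cdot>\<^sub>v v"
    using unitary_completion[OF v(1,2)] by blast
  have WW': "W * mat_adjoint W = 1\<^sub>m ?n"
    by (rule mat_mult_left_right_inverse[OF _ W WW]) (use W in auto)
  define B where "B = mat_adjoint W * (A * W)"
  have B: "B \<in> carrier_mat ?n ?n"
    unfolding B_def using A W by (auto intro!: mult_carrier_mat)
  have AW: "A * W = W * B"
  proof -
    have "W * B = (W * mat_adjoint W) * (A * W)"
      unfolding B_def using A W
      by (intro assoc_mult_mat[symmetric]) (auto intro!: mult_carrier_mat)
    then show ?thesis using A W WW' by simp
  qed
  have B_herm: "mat_adjoint B = B"
    using Suc.prems(2) A W unfolding B_def hermitian_mat_def
    by (simp add: mat_adjoint_mult[of _ ?n ?n _ ?n] assoc_mult_mat[of _ ?n ?n _ ?n _ ?n]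
        mult_carrier_mat[of _ ?n ?n _ ?n])
  \<comment> \<open>The first column of \<open>W\<close> is an eigenvector for \<open>e\<close>, so
    the first column of \<open>B\<close> is \<open>e\<close> times that of
    \<open>mat_adjoint W * W\<close>, which is the identity.\<close>
  have B0: "B $$ (i, 0) = (if i = 0 then e else 0)" if i: "i < ?n" for i
  proof -
    have "A *\<^sub>v col W 0 = e \<cdot>\<^sub>v col W 0"
      unfolding W0 using A v by (simp add: mult_mat_vec[of _ ?n ?n] smult_smult_assoc mult.commute)
    then have "col (A * W) 0 = e \<cdot>\<^sub>v col W 0"
      unfolding col_mult2[OF A W zero_less_Suc] .
    then have "B $$ (i, 0) = e * (mat_adjoint W * W) $$ (i, 0)"
      unfolding B_def using A W i
      by (simp add: scalar_prod_smult_distrib[of _ ?n] del: col_mult2)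
    then show ?thesis using i unfolding WW by simp
  qed
  define D where "D = mat m m (\<lambda>(i, j). B $$ (Suc i, Suc j))"
  have D: "D \<in> carrier_mat m m" by (simp add: D_def)
  define E where "E = mat 1 1 (\<lambda>_. e)"
  have E: "E \<in> carrier_mat 1 1" by (simp add: E_def)
  \<comment> \<open>Hermitian symmetry carries the zeros of the first column over to the first row,
    which gives the block form.\<close>
  have "B $$ (0, j) = 0" if "0 < j" "j < ?n" for j
    using B B0[of j] that arg_cong[OF B_herm, of "\<lambda>M. M $$ (0, j)"] by simp
  then have B_block: "B = four_block_mat E (0\<^sub>m 1 m) (0\<^sub>m m 1) D"
    using B B0 by (intro eq_matI) (auto simp: D_def E_def)
  have "hermitian_mat D"
    unfolding hermitian_mat_def
  proof (rule eq_matI)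
    fix i j assume "i < dim_row D" "j < dim_col D"
    then show "mat_adjoint D $$ (i, j) = D $$ (i, j)"
      using D B arg_cong[OF B_herm, of "\<lambda>M. M $$ (Suc i, Suc j)"] by (simp add: D_def)
  qed (use D in auto)
  from Suc.IH[OF D this] obtain U d where U: "U \<in> carrier_mat m m"
    and UU: "mat_adjoint U * U = 1\<^sub>m m" and DU: "D * U = U * mat_diag m d"
    by blast
  \<comment> \<open>\<open>P\<close> diagonalises the lower block and fixes the first coordinate, so
    \<open>W * P\<close> diagonalises \<open>A\<close>. The function \<open>case_nat e d\<close>
    puts \<open>e\<close> in front of the eigenvalues of the lower block.\<close>
  define P where "P = four_block_mat (1\<^sub>m 1) (0\<^sub>m 1 m) (0\<^sub>m m 1) U"
  have P: "P \<in> carrier_mat ?n ?n"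
    using U by (auto simp: P_def)
  have PP: "mat_adjoint P * P = 1\<^sub>m ?n"
    unfolding P_def using U UU
    by (simp add: mat_adjoint_four_block_diag mult_four_block_diag plus_1_eq_Suc del: One_nat_def)
  have diag: "mat_diag ?n (case_nat e d) = four_block_mat E (0\<^sub>m 1 m) (0\<^sub>m m 1) (mat_diag m d)"
    by (intro eq_matI) (auto simp: mat_diag_def E_def split: nat.split)
  have BP: "B * P = P * mat_diag ?n (case_nat e d)"
    unfolding P_def B_block diag using U D E DU
    by (simp add: mult_four_block_diag del: One_nat_def)
  have "A * (W * P) = (W * P) * mat_diag ?n (case_nat e d)"
  proof -
    have "A * (W * P) = (A * W) * P"
      by (rule assoc_mult_mat[symmetric, OF A W P])
    also have "\<dots> = W * (B * P)"
      unfolding AW by (rule assoc_mult_mat[OF W B P])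
    also have "\<dots> = (W * P) * mat_diag ?n (case_nat e d)"
      unfolding BP by (rule assoc_mult_mat[symmetric, OF W P mat_diag_dim])
    finally show ?thesis .
  qed
  moreover have "W * P \<in> carrier_mat ?n ?n" using W P by simp
  ultimately show ?case using unitary_mult[OF W WW P PP] by blast
qed

lemma col_mult_mat_diag:
  fixes U :: "complex mat"
  assumes "U \<in> carrier_mat n n" "i < n"
  shows "col (U * mat_diag n d) i = d i \<cdot>\<^sub>v col U i"
  using assms by (intro eq_vecI) (auto simp: mat_diag_mult_right[of _ n] mult.commute)

text \<open>Conjugating a Hermitian matrix by a unitary one gives a Hermitian matrix, so the
  diagonal entries are real. The last clause, obtained from the columns of \<open>U\<close>, allows
  each \<open>d i\<close> to be compared with the extreme eigenvalues.\<close>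

lemma hermitian_spectral_theorem:
  assumes A: "A \<in> carrier_mat n n" and herm: "hermitian_mat A"
  obtains U d where "U \<in> carrier_mat n n" "mat_adjoint U * U = 1\<^sub>m n" "U * mat_adjoint U = 1\<^sub>m n"
    "A = U * mat_diag n (\<lambda>i. complex_of_real (d i)) * mat_adjoint U"
    "\<And>i. i < n \<Longrightarrow> eigenvalue A (complex_of_real (d i))"
proof -
  obtain U d where U: "U \<in> carrier_mat n n" and UU: "mat_adjoint U * U = 1\<^sub>m n"
    and AU: "A * U = U * mat_diag n d"
    using hermitian_diagonalizable[OF assms] by blast
  have UU': "U * mat_adjoint U = 1\<^sub>m n"
    by (rule mat_mult_left_right_inverse[OF _ U UU]) (use U in auto)
  have "mat_adjoint U * (A * U) = (mat_adjoint U * U) * mat_diag n d"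
    unfolding AU by (rule assoc_mult_mat[symmetric, of _ n n _ n _ n]) (use U in auto)
  then have "mat_diag n d = mat_adjoint U * (A * U)"
    unfolding UU by (metis left_mult_one_mat mat_diag_dim)
  moreover have "mat_adjoint (mat_adjoint U * (A * U)) = mat_adjoint U * (A * U)"
    using herm A U unfolding hermitian_mat_def
    by (simp add: mat_adjoint_mult[of _ n n _ n] assoc_mult_mat[of _ n n _ n _ n]
        mult_carrier_mat[of _ n n _ n])
  ultimately have "mat_diag n (\<lambda>i. cnj (d i)) = mat_diag n d"
    by (simp flip: mat_adjoint_mat_diag)
  then have "mat_diag n (\<lambda>i. cnj (d i)) $$ (i, i) = mat_diag n d $$ (i, i)" if "i < n" for i
    by simp
  moreover have "mat_diag n f $$ (i, i) = f i" if "i < n" for i and f :: "nat \<Rightarrow> complex"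
    using that by (simp add: mat_diag_def)
  ultimately have "cnj (d i) = d i" if "i < n" for i
    using that by metis
  then have dr: "d i = complex_of_real (Re (d i))" if "i < n" for i
    using that by (metis Reals_cnj_iff of_real_Re)
  have diag: "mat_diag n d = mat_diag n (\<lambda>i. complex_of_real (Re (d i)))"
    using dr by (intro eq_matI) (auto simp: mat_diag_def)
  have "A = A * (U * mat_adjoint U)" using A UU' by simp
  also have "\<dots> = U * mat_diag n d * mat_adjoint U"
    unfolding AU[symmetric] using A U by (metis assoc_mult_mat mat_adjoint_carrier)
  finally have A_eq: "A = U * mat_diag n (\<lambda>i. complex_of_real (Re (d i))) * mat_adjoint U"
    unfolding diag .
  have ev: "eigenvalue A (complex_of_real (Re (d i)))" if i: "i < n" for i
  proof -
    \<comment> \<open>A zero column would put a 0 instead of a 1 on the diagonal of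
      \<open>mat_adjoint U * U\<close>.\<close>
    have "col U i \<noteq> 0\<^sub>v n"
    proof
      assume "col U i = 0\<^sub>v n"
      then have "(mat_adjoint U * U) $$ (i, i) = 0" using U i by simp
      then show False unfolding UU using i by simp
    qed
    moreover have "A *\<^sub>v col U i = d i \<cdot>\<^sub>v col U i"
      using col_mult2[OF A U i] col_mult_mat_diag[OF U i] unfolding AU by metis
    ultimately show ?thesis
      unfolding eigenvalue_def eigenvector_def using U A i dr[OF i] by (intro exI[of _ "col U i"]) auto
  qed
  show thesis by (rule that[OF U UU UU' A_eq ev])
qed

text \<open>In the coordinates of the eigenbasis the form is a sum of squares weighted by the
  eigenvalues.\<close>

lemma herm_form_spectral:
  assumes U: "U \<in> carrier_mat n n" and v: "v \<in> carrier_vec n"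
    and A: "A = U * mat_diag n (\<lambda>i. complex_of_real (d i)) * mat_adjoint U"
  shows "herm_form A v = (\<Sum>i<n. d i * (cmod ((mat_adjoint U *\<^sub>v v) $ i))\<^sup>2)"
proof -
  let ?D = "mat_diag n (\<lambda>i. complex_of_real (d i))"
  define w where "w = mat_adjoint U *\<^sub>v v"
  have w: "w \<in> carrier_vec n"
    unfolding w_def by (rule mult_mat_vec_carrier[of _ n n]) (use U v in auto)
  have "herm_form A v = herm_form ?D w"
    using herm_form_congruence[of ?D n "mat_adjoint U" v] U v
    unfolding A w_def by simp
  also have "?D *\<^sub>v w = vec n (\<lambda>i. complex_of_real (d i) * w $ i)"
    using w by (intro eq_vecI) (auto simp: mat_diag_def scalar_prod_def if_distrib[of "\<lambda>x. x * _"]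
      cong: if_cong)
  also have "\<dots> \<bullet>c w = complex_of_real (\<Sum>i<n. d i * (cmod (w $ i))\<^sup>2)"
    using w by (simp add: cscalar_prod_eq_sum[of _ n] complex_norm_square mult.assoc
        del: of_real_power)
  finally show ?thesis by (simp add: w_def)
qed

text \<open>This is the spectral formula for the identity matrix, all of whose eigenvalues are
  1.\<close>

lemma cscalar_prod_unitary:
  fixes U :: "complex mat"
  assumes U: "U \<in> carrier_mat n n" "U * mat_adjoint U = 1\<^sub>m n" and v: "v \<in> carrier_vec n"
  shows "Re (v \<bullet>c v) = (\<Sum>i<n. (cmod ((mat_adjoint U *\<^sub>v v) $ i))\<^sup>2)"
proof -
  have "(1\<^sub>m n :: complex mat) = U * mat_diag n (\<lambda>i. complex_of_real 1) * mat_adjoint U"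
    using U by simp
  from herm_form_spectral[OF U(1) v this] show ?thesis using v by simp
qed

section \<open>Rayleigh bounds and positive semidefinite square roots\<close>

text \<open>In eigenbasis coordinates the form and the squared norm are sums over the same squares,
  with weights \<open>d i\<close> and 1, and every \<open>d i\<close> lies between the extreme
  eigenvalues.\<close>

lemma rayleigh_bounds:
  assumes A: "A \<in> carrier_mat n n" "hermitian_mat A" and n: "n > 0" and v: "v \<in> carrier_vec n"
  shows "herm_form A v \<le> lambda_max A * Re (v \<bullet>c v)" (is ?ub)
    and "lambda_min A * Re (v \<bullet>c v) \<le> herm_form A v" (is ?lb)
    and "eigenvalue A (complex_of_real (lambda_max A))"
    and "eigenvalue A (complex_of_real (lambda_min A))"
proof -
  let ?E = "{r :: real. eigenvalue A (complex_of_real r)}"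
  obtain U d where U: "U \<in> carrier_mat n n" "U * mat_adjoint U = 1\<^sub>m n"
    and A_eq: "A = U * mat_diag n (\<lambda>i. complex_of_real (d i)) * mat_adjoint U"
    and ev: "\<And>i. i < n \<Longrightarrow> eigenvalue A (complex_of_real (d i))"
    using hermitian_spectral_theorem[OF A] by metis
  \<comment> \<open>\<open>Max\<close> and \<open>Min\<close> are meaningful only on a finite
    nonempty set. Finiteness comes from that of the spectrum and the injectivity of
    \<open>complex_of_real\<close>; nonemptiness uses \<open>n > 0\<close>.\<close>
  have "finite (complex_of_real -` spectrum A)"
    using card_finite_spectrum(1)[OF A(1)] by (rule finite_vimageI) (simp add: inj_def)
  then have fin: "finite ?E"
    by (simp add: spectrum_def vimage_def)
  have ne: "?E \<noteq> {}" using ev[OF n] by blast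
  show "eigenvalue A (complex_of_real (lambda_max A))" "eigenvalue A (complex_of_real (lambda_min A))"
    using Max_in[OF fin ne] Min_in[OF fin ne] by (auto simp: lambda_max_def lambda_min_def)
  have d: "d i \<le> lambda_max A" "lambda_min A \<le> d i" if "i < n" for i
    using ev[OF that] fin by (auto simp: lambda_max_def lambda_min_def)
  show ?ub ?lb
    unfolding herm_form_spectral[OF U(1) v A_eq] cscalar_prod_unitary[OF U v] sum_distrib_left
    by (auto intro!: sum_mono mult_right_mono d)
qed

lemma cscalar_prod_self_pos:
  fixes v :: "complex vec"
  assumes "v \<in> carrier_vec n" "v \<noteq> 0\<^sub>v n"
  shows "Re (v \<bullet>c v) > 0"
  using conjugate_square_greater_0_vec[OF assms(1)] assms(2) by (auto simp: less_complex_def)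

lemma herm_form_eigenvalue:
  assumes "A \<in> carrier_mat n n" "eigenvalue A (complex_of_real r)"
  obtains v where "v \<in> carrier_vec n" "v \<noteq> 0\<^sub>v n" "A *\<^sub>v v = complex_of_real r \<cdot>\<^sub>v v"
    "herm_form A v = r * Re (v \<bullet>c v)"
proof -
  obtain v where v: "v \<in> carrier_vec n" "v \<noteq> 0\<^sub>v n" "A *\<^sub>v v = complex_of_real r \<cdot>\<^sub>v v"
    using assms unfolding eigenvalue_def eigenvector_def by auto
  then have "herm_form A v = r * Re (v \<bullet>c v)" by simp
  then show thesis using that v by blast
qed

text \<open>One direction is the Rayleigh bound, the other tests the inequality on an eigenvector
  for \<open>lambda_max A\<close>. From here on, eigenvalue bounds can be handled as inequalities
  between forms.\<close>

lemma lambda_max_le_iff: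
  assumes A: "A \<in> carrier_mat n n" "hermitian_mat A" and n: "n > 0"
  shows "lambda_max A \<le> c \<longleftrightarrow> (\<forall>v \<in> carrier_vec n. herm_form A v \<le> c * Re (v \<bullet>c v))"
proof
  assume c: "lambda_max A \<le> c"
  show "\<forall>v \<in> carrier_vec n. herm_form A v \<le> c * Re (v \<bullet>c v)"
  proof
    fix v :: "complex vec" assume v: "v \<in> carrier_vec n"
    have "lambda_max A * Re (v \<bullet>c v) \<le> c * Re (v \<bullet>c v)"
      using cscalar_prod_self[OF v] by (intro mult_right_mono[OF c]) (simp add: sum_nonneg)
    then show "herm_form A v \<le> c * Re (v \<bullet>c v)"
      using rayleigh_bounds(1)[OF A n v] by linarith
  qed
next
  assume *: "\<forall>v \<in> carrier_vec n. herm_form A v \<le> c * Re (v \<bullet>c v)"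
  obtain v where "v \<in> carrier_vec n" "v \<noteq> 0\<^sub>v n" "herm_form A v = lambda_max A * Re (v \<bullet>c v)"
    using herm_form_eigenvalue[OF A(1) rayleigh_bounds(3)[OF A n zero_carrier_vec]] by metis
  then show "lambda_max A \<le> c"
    using * cscalar_prod_self_pos by (metis mult_le_cancel_right_pos)
qed

lemma le_lambda_min_iff:
  assumes A: "A \<in> carrier_mat n n" "hermitian_mat A" and n: "n > 0"
  shows "c \<le> lambda_min A \<longleftrightarrow> (\<forall>v \<in> carrier_vec n. c * Re (v \<bullet>c v) \<le> herm_form A v)"
proof
  assume c: "c \<le> lambda_min A"
  show "\<forall>v \<in> carrier_vec n. c * Re (v \<bullet>c v) \<le> herm_form A v"
  proof
    fix v :: "complex vec" assume v: "v \<in> carrier_vec n"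
    have "c * Re (v \<bullet>c v) \<le> lambda_min A * Re (v \<bullet>c v)"
      using cscalar_prod_self[OF v] by (intro mult_right_mono[OF c]) (simp add: sum_nonneg)
    then show "c * Re (v \<bullet>c v) \<le> herm_form A v"
      using rayleigh_bounds(2)[OF A n v] by linarith
  qed
next
  assume *: "\<forall>v \<in> carrier_vec n. c * Re (v \<bullet>c v) \<le> herm_form A v"
  obtain v where "v \<in> carrier_vec n" "v \<noteq> 0\<^sub>v n" "herm_form A v = lambda_min A * Re (v \<bullet>c v)"
    using herm_form_eigenvalue[OF A(1) rayleigh_bounds(4)[OF A n zero_carrier_vec]] by metis
  then show "c \<le> lambda_min A"
    using * cscalar_prod_self_pos by (metis mult_le_cancel_right_pos)
qed

section \<open>Existence and uniqueness of the positive semidefinite square root\<close>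

lemma pos_semidef_sqrt_exists:
  assumes A: "A \<in> pos_semidef_mats n"
  shows "\<exists>S \<in> pos_semidef_mats n. S * S = A"
proof -
  have Ac: "A \<in> carrier_mat n n" "hermitian_mat A"
    and Ap: "\<And>v. v \<in> carrier_vec n \<Longrightarrow> herm_form A v \<ge> 0"
    using A by (auto simp: pos_semidef_mats_def)
  obtain U d where U: "U \<in> carrier_mat n n" "mat_adjoint U * U = 1\<^sub>m n"
    and A_eq: "A = U * mat_diag n (\<lambda>i. complex_of_real (d i)) * mat_adjoint U"
    and ev: "\<And>i. i < n \<Longrightarrow> eigenvalue A (complex_of_real (d i))"
    using hermitian_spectral_theorem[OF Ac] by metis
  \<comment> \<open>At an eigenvector for \<open>d i\<close> the form equals \<open>d i\<close>
    times a positive number, so \<open>d i\<close> is nonnegative and has a real root.\<close>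
  have d: "d i \<ge> 0" if i: "i < n" for i
  proof -
    obtain v where v: "v \<in> carrier_vec n" "v \<noteq> 0\<^sub>v n" "herm_form A v = d i * Re (v \<bullet>c v)"
      using herm_form_eigenvalue[OF Ac(1) ev[OF i]] by metis
    then show ?thesis
      using Ap[OF v(1)] cscalar_prod_self_pos[OF v(1,2)] by (simp add: zero_le_mult_iff)
  qed
  let ?D = "mat_diag n (\<lambda>i. complex_of_real (sqrt (d i)))"
  define S where "S = U * ?D * mat_adjoint U"
  have S: "S \<in> carrier_mat n n"
    unfolding S_def using U by (auto intro!: mult_carrier_mat)
  have "hermitian_mat S"
    unfolding S_def hermitian_mat_def using U(1)
    by (simp add: mat_adjoint_mult[of _ n n _ n] mat_adjoint_mat_diag
        assoc_mult_mat[of _ n n _ n _ n] mult_carrier_mat[of _ n n _ n])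
  moreover have "herm_form S v \<ge> 0" if "v \<in> carrier_vec n" for v
    unfolding herm_form_spectral[OF U(1) that S_def] using d by (auto intro!: sum_nonneg)
  moreover have "S * S = A"
  proof -
    have "S * S = U * (?D * ((mat_adjoint U * U) * (?D * mat_adjoint U)))"
      unfolding S_def using U(1)
      by (simp add: assoc_mult_mat[of _ n n _ n _ n] mult_carrier_mat[of _ n n _ n])
    also have "\<dots> = U * (?D * ?D) * mat_adjoint U"
      using U by (simp add: assoc_mult_mat[of _ n n _ n _ n] mult_carrier_mat[of _ n n _ n]
          left_mult_one_mat[of _ n n] del: mat_diag_diag)
    also have "?D * ?D = mat_diag n (\<lambda>i. complex_of_real (d i))"
      unfolding mat_diag_diag using d
      by (intro eq_matI) (auto simp: mat_diag_def simp flip: of_real_mult)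
    finally show ?thesis unfolding A_eq .
  qed
  ultimately show ?thesis using S by (auto simp: pos_semidef_mats_def)
qed

text \<open>If \<open>S v = T v + \<mu> v\<close>, then \<open>S\<^sup>2 = T\<^sup>2\<close> gives \<open>0 = \<parallel>S v\<parallel>\<^sup>2 - \<parallel>T v\<parallel>\<^sup>2 = 2 \<mu> \<langle>T v, v\<rangle> + \<mu>\<^sup>2 \<parallel>v\<parallel>\<^sup>2\<close>,
  which is positive when \<open>\<mu> > 0\<close>.\<close>

lemma sqrt_difference_eigenvalue_nonpos:
  assumes S: "S \<in> carrier_mat n n" "hermitian_mat S" and T: "T \<in> pos_semidef_mats n"
    and sq: "S * S = T * T"
    and ev: "eigenvalue (S - T) (complex_of_real r)"
  shows "r \<le> 0"
proof (rule ccontr)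
  assume r: "\<not> r \<le> 0"
  have Tc: "T \<in> carrier_mat n n" and T_herm: "mat_adjoint T = T"
    and Tp: "\<And>v. v \<in> carrier_vec n \<Longrightarrow> herm_form T v \<ge> 0"
    using T by (auto simp: pos_semidef_mats_def hermitian_mat_def)
  have S_herm: "mat_adjoint S = S" using S by (simp add: hermitian_mat_def)
  obtain v where v: "v \<in> carrier_vec n" "v \<noteq> 0\<^sub>v n" "(S - T) *\<^sub>v v = complex_of_real r \<cdot>\<^sub>v v"
    using herm_form_eigenvalue[OF minus_carrier_mat[OF Tc] ev] by metis
  define a where "a = S *\<^sub>v v"
  define b where "b = T *\<^sub>v v"
  have ab: "a \<in> carrier_vec n" "b \<in> carrier_vec n" using S Tc v by (auto simp: a_def b_def)
  have a_eq: "a = b + complex_of_real r \<cdot>\<^sub>v v"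
  proof -
    have "a - b = complex_of_real r \<cdot>\<^sub>v v"
      using v S Tc by (simp add: a_def b_def minus_mult_distrib_mat_vec[of _ n n])
    then have "(a - b) $ i = (complex_of_real r \<cdot>\<^sub>v v) $ i" for i by simp
    then have "a $ i = b $ i + complex_of_real r * v $ i" if "i < n" for i
      using ab v(1) that by (metis add.commute carrier_vecD diff_add_cancel index_minus_vec(1) index_smult_vec(1))
    then show ?thesis using ab v(1) by (intro eq_vecI) auto
  qed
  have norm_sq: "(M *\<^sub>v v) \<bullet>c (M *\<^sub>v v) = ((M * M) *\<^sub>v v) \<bullet>c v"
    if "M \<in> carrier_mat n n" "mat_adjoint M = M" for M
    using cscalar_prod_mult_mat_vec[of M n n "M *\<^sub>v v" v] that v(1)
    by (simp add: assoc_mult_mat_vec[of _ n n _ n])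
  have "Re (a \<bullet>c a) = Re (b \<bullet>c b)"
    using norm_sq[OF S(1) S_herm] norm_sq[OF Tc T_herm] sq by (simp add: a_def b_def)
  moreover have "Re (a \<bullet>c a) = Re (b \<bullet>c b) + 2 * r * herm_form T v + r\<^sup>2 * Re (v \<bullet>c v)"
  proof -
    have a_left: "a \<bullet>c w = b \<bullet>c w + complex_of_real r * (v \<bullet>c w)" if "w \<in> carrier_vec n" for w
      unfolding a_eq using ab(2) v(1) that by (simp add: add_scalar_prod_distrib[of _ n])
    \<comment> \<open>Only the first argument is expanded by \<open>a_left\<close>; conjugate
      symmetry moves the second \<open>a\<close> into first position so that it can be expanded in
      the same way.\<close>
    have "a \<bullet>c a = cnj (a \<bullet>c b) + complex_of_real r * cnj (a \<bullet>c v)"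
      using a_left[OF ab(1)] cscalar_prod_commute[OF ab(1,2)] cscalar_prod_commute[OF ab(1) v(1)]
      by simp
    then have "Re (a \<bullet>c a) = Re (b \<bullet>c b) + r * Re (v \<bullet>c b) + r * (Re (b \<bullet>c v) + r * Re (v \<bullet>c v))"
      unfolding a_left[OF ab(2)] a_left[OF v(1)] by simp
    moreover have "Re (v \<bullet>c b) = Re (b \<bullet>c v)"
      unfolding cscalar_prod_commute[OF ab(2) v(1)] by simp
    ultimately show ?thesis
      unfolding b_def by (simp add: power2_eq_square algebra_simps)
  qed
  moreover have "2 * r * herm_form T v \<ge> 0" using r Tp[OF v(1)] by simp
  moreover have "r\<^sup>2 * Re (v \<bullet>c v) > 0" using r cscalar_prod_self_pos[OF v(1,2)] by simp
  ultimately show False by linarith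
qed

text \<open>The preceding lemma, applied to both \<open>S - T\<close> and \<open>T - S\<close>,
  forces every eigenvalue of the Hermitian matrix \<open>S - T\<close> to be 0. By the spectral
  theorem the difference then vanishes.\<close>

lemma pos_semidef_sqrt_unique:
  assumes S: "S \<in> pos_semidef_mats n" and T: "T \<in> pos_semidef_mats n" and sq: "S * S = T * T"
  shows "S = T"
proof -
  have Sc: "S \<in> carrier_mat n n" "hermitian_mat S" and Tc: "T \<in> carrier_mat n n" "hermitian_mat T"
    using S T by (auto simp: pos_semidef_mats_def)
  have "S - T \<in> carrier_mat n n" "hermitian_mat (S - T)"
    using Sc Tc by (auto simp: hermitian_mat_def mat_adjoint_minus)
  then obtain U d where U: "U \<in> carrier_mat n n"
    and ST: "S - T = U * mat_diag n (\<lambda>i. complex_of_real (d i)) * mat_adjoint U"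
    and ev: "\<And>i. i < n \<Longrightarrow> eigenvalue (S - T) (complex_of_real (d i))"
    using hermitian_spectral_theorem by metis
  have "d i = 0" if i: "i < n" for i
  proof (rule antisym)
    show "d i \<le> 0"
      by (rule sqrt_difference_eigenvalue_nonpos[OF Sc T sq ev[OF i]])
    obtain v where v: "v \<in> carrier_vec n" "v \<noteq> 0\<^sub>v n" "(S - T) *\<^sub>v v = complex_of_real (d i) \<cdot>\<^sub>v v"
      using herm_form_eigenvalue[OF minus_carrier_mat[OF Tc(1)] ev[OF i]] by metis
    have "(T - S) *\<^sub>v v = - ((S - T) *\<^sub>v v)"
      using Sc Tc v(1) by (intro eq_vecI) (auto simp: minus_mult_distrib_mat_vec[of _ n n])
    also have "\<dots> = complex_of_real (- d i) \<cdot>\<^sub>v v"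
      unfolding v(3) by (intro eq_vecI) auto
    finally have "eigenvalue (T - S) (complex_of_real (- d i))"
      unfolding eigenvalue_def eigenvector_def using v Sc Tc by (intro exI[of _ v]) auto
    from sqrt_difference_eigenvalue_nonpos[OF Tc S sq[symmetric] this] show "0 \<le> d i" by simp
  qed
  then have "mat_diag n (\<lambda>i. complex_of_real (d i)) = 0\<^sub>m n n"
    by (intro eq_matI) (auto simp: mat_diag_def)
  then have "S - T = 0\<^sub>m n n"
    unfolding ST using U by (simp add: right_mult_zero_mat[of _ n n] left_mult_zero_mat[of _ n n])
  then have "(S - T) $$ (i, j) = 0" if "i < n" "j < n" for i j
    using that by simp
  then show ?thesis using Sc Tc by (intro eq_matI) auto
qed

text \<open>Existence and uniqueness together justify the definite description behind
  \<open>psd_sqrt\<close>.\<close>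

lemma psd_sqrt:
  assumes "A \<in> pos_semidef_mats n"
  shows "psd_sqrt A \<in> pos_semidef_mats n" "psd_sqrt A * psd_sqrt A = A"
proof -
  have "psd_sqrt A = (THE S. S \<in> pos_semidef_mats n \<and> S * S = A)"
    using assms by (auto simp: psd_sqrt_def pos_semidef_mats_def)
  moreover have "\<exists>!S. S \<in> pos_semidef_mats n \<and> S * S = A"
    using pos_semidef_sqrt_exists[OF assms] pos_semidef_sqrt_unique by blast
  note theI'[OF this]
  ultimately show "psd_sqrt A \<in> pos_semidef_mats n" "psd_sqrt A * psd_sqrt A = A"
    by simp_all
qed

section \<open>Inverses and inverse square roots of positive definite matrices\<close>

lemma pos_def_inverse:
  assumes A: "A \<in> pos_def_mats n"
  obtains B where "mat_inverse A = Some B" "B * A = 1\<^sub>m n" "B \<in> pos_semidef_mats n"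
proof -
  have Ac: "A \<in> carrier_mat n n" and A_herm: "mat_adjoint A = A"
    and Ap: "\<And>v. v \<in> carrier_vec n \<Longrightarrow> v \<noteq> 0\<^sub>v n \<Longrightarrow> herm_form A v > 0"
    using A by (auto simp: pos_def_mats_def hermitian_mat_def)
  have "det A \<noteq> 0"
  proof
    assume "det A = 0"
    then obtain v where v: "v \<in> carrier_vec n" "v \<noteq> 0\<^sub>v n" "A *\<^sub>v v = 0\<^sub>v n"
      using det_0_iff_vec_prod_zero_field[OF Ac] by blast
    then show False using Ap[OF v(1,2)] by simp
  qed
  then have "mat_inverse A \<noteq> None"
    using mat_inverse(1)[OF Ac, of "()"] det_non_zero_imp_unit[OF Ac, of "()"] by blast
  then obtain B where B_inv: "mat_inverse A = Some B" by auto
  from mat_inverse(2)[OF Ac this]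
  have AB: "A * B = 1\<^sub>m n" and BA: "B * A = 1\<^sub>m n" and B: "B \<in> carrier_mat n n" by auto
  have BA': "mat_adjoint B * A = 1\<^sub>m n"
    using arg_cong[OF AB, of mat_adjoint] Ac B A_herm by (simp add: mat_adjoint_mult[of _ n n _ n])
  \<comment> \<open>Left and right inverses agree: \<open>mat_adjoint B * (A * B)\<close> and
    \<open>(mat_adjoint B * A) * B\<close> are the two sides.\<close>
  have "mat_adjoint B = B"
    using assoc_mult_mat[OF mat_adjoint_carrier[OF B] Ac B] B unfolding BA' AB by simp
  moreover have "herm_form B v \<ge> 0" if v: "v \<in> carrier_vec n" for v
  proof -
    \<comment> \<open>Substituting \<open>v = A *\<^sub>v w\<close> turns the form of
      \<open>B\<close> at \<open>v\<close> into the form of \<open>A\<close> at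
      \<open>w\<close>.\<close>
    define w where "w = B *\<^sub>v v"
    have w: "w \<in> carrier_vec n" using B v by (simp add: w_def)
    have "A *\<^sub>v w = v"
      unfolding w_def using Ac B v AB by (simp flip: assoc_mult_mat_vec[of _ n n _ n])
    then have "herm_form B v = herm_form A w"
      using cscalar_prod_commute[OF v w] by (simp add: w_def)
    then show ?thesis
      using Ap[OF w] w Ac by (cases "w = 0\<^sub>v n") auto
  qed
  ultimately have "B \<in> pos_semidef_mats n"
    using B by (auto simp: pos_semidef_mats_def hermitian_mat_def)
  then show thesis using that B_inv BA by blast
qed

text \<open>Write \<open>S = inv_sqrt A\<close>. Since \<open>S * S\<close> is the inverse of
  \<open>A\<close>, the product \<open>S * A\<close> is a right inverse of the square matrix
  \<open>S\<close>, hence also a left inverse. No commutation of \<open>S\<close> with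
  \<open>A\<close> has to be shown.\<close>

lemma inv_sqrt_pos_def:
  assumes A: "A \<in> pos_def_mats n"
  shows "inv_sqrt A \<in> carrier_mat n n" "mat_adjoint (inv_sqrt A) = inv_sqrt A"
    "inv_sqrt A * A * inv_sqrt A = 1\<^sub>m n" "inv_sqrt A * (inv_sqrt A * A) = 1\<^sub>m n"
proof -
  let ?S = "inv_sqrt A"
  obtain B where B: "mat_inverse A = Some B" "B * A = 1\<^sub>m n" "B \<in> pos_semidef_mats n"
    using pos_def_inverse[OF A] by blast
  have Ac: "A \<in> carrier_mat n n" using A by (auto simp: pos_def_mats_def)
  have SS: "?S * ?S = B" and S: "?S \<in> carrier_mat n n" and herm: "mat_adjoint ?S = ?S"
    using psd_sqrt[OF B(3)] B(1) by (auto simp: inv_sqrt_def pos_semidef_mats_def hermitian_mat_def)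
  show "?S \<in> carrier_mat n n" "mat_adjoint ?S = ?S" by fact+
  show right: "?S * (?S * A) = 1\<^sub>m n"
    using S Ac SS B(2) by (simp flip: assoc_mult_mat[of _ n n _ n _ n])
  show "?S * A * ?S = 1\<^sub>m n"
    by (rule mat_mult_left_right_inverse[OF S _ right]) (use S Ac in auto)
qed

section \<open>The Loewner order as comparison of forms\<close>

lemma loewner_le_iff:
  assumes "A \<in> carrier_mat n n" "hermitian_mat A" "B \<in> carrier_mat n n" "hermitian_mat B"
  shows "loewner_le n A B \<longleftrightarrow> (\<forall>v \<in> carrier_vec n. herm_form A v \<le> herm_form B v)"
proof -
  have "B - A \<in> carrier_mat n n" "hermitian_mat (B - A)"
    using assms by (auto simp: hermitian_mat_def mat_adjoint_minus)
  moreover have "herm_form (B - A) v = herm_form B v - herm_form A v" if "v \<in> carrier_vec n" for v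
    using assms(3,1) that by (rule herm_form_minus)
  ultimately show ?thesis
    unfolding loewner_le_def pos_semidef_mats_def by fastforce
qed

section \<open>The minimax problem\<close>

lemma herm_form_inv_sqrt:
  assumes Y: "Y \<in> pos_def_mats n" and X: "X \<in> carrier_mat n n" and v: "v \<in> carrier_vec n"
  shows "herm_form (inv_sqrt Y * X * inv_sqrt Y) v = herm_form X (inv_sqrt Y *\<^sub>v v)"
    and "Re (v \<bullet>c v) = herm_form Y (inv_sqrt Y *\<^sub>v v)"
proof -
  have Yc: "Y \<in> carrier_mat n n" using Y by (auto simp: pos_def_mats_def)
  note S = inv_sqrt_pos_def[OF Y]
  show "herm_form (inv_sqrt Y * X * inv_sqrt Y) v = herm_form X (inv_sqrt Y *\<^sub>v v)"
    using herm_form_congruence[OF X S(1) v] S(2) by simp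
  show "Re (v \<bullet>c v) = herm_form Y (inv_sqrt Y *\<^sub>v v)"
    using herm_form_congruence[OF Yc S(1) v] S(2,3) v by simp
qed

text \<open>The substitution \<open>w = inv_sqrt Y *\<^sub>v v\<close> turns the squared norm of
  \<open>v\<close> into the form of \<open>Y\<close> at \<open>w\<close>. As it reaches every
  vector, the extreme eigenvalues are the best constants in comparing the form of \<open>X\<close>
  with that of \<open>Y\<close>.\<close>

lemma lambda_inv_sqrt_iff:
  assumes Y: "Y \<in> pos_def_mats n" and X: "X \<in> pos_def_mats n" and n: "n > 0"
  shows "lambda_max (inv_sqrt Y * X * inv_sqrt Y) \<le> c \<longleftrightarrow>
      (\<forall>v \<in> carrier_vec n. herm_form X v \<le> c * herm_form Y v)" (is ?max)
    and "c \<le> lambda_min (inv_sqrt Y * X * inv_sqrt Y) \<longleftrightarrow>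
      (\<forall>v \<in> carrier_vec n. c * herm_form Y v \<le> herm_form X v)" (is ?min)
proof -
  let ?S = "inv_sqrt Y"
  let ?M = "?S * X * ?S"
  have Xc: "X \<in> carrier_mat n n" "mat_adjoint X = X" and Yc: "Y \<in> carrier_mat n n"
    using X Y by (auto simp: pos_def_mats_def hermitian_mat_def)
  note S = inv_sqrt_pos_def[OF Y]
  have M: "?M \<in> carrier_mat n n" using S(1) Xc(1) by (auto intro!: mult_carrier_mat)
  have M_herm: "hermitian_mat ?M"
    unfolding hermitian_mat_def using S(1,2) Xc
    by (simp add: mat_adjoint_mult[of _ n n _ n] assoc_mult_mat[of _ n n _ n _ n]
        mult_carrier_mat[of _ n n _ n])
  have surj: "carrier_vec n = (\<lambda>v. ?S *\<^sub>v v) ` carrier_vec n"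
  proof (intro equalityI subsetI)
    fix w :: "complex vec" assume w: "w \<in> carrier_vec n"
    have "?S *\<^sub>v ((?S * Y) *\<^sub>v w) = w"
      using assoc_mult_mat_vec[of ?S n n "?S * Y" n w] S Yc w by simp
    moreover have "(?S * Y) *\<^sub>v w \<in> carrier_vec n" using S(1) Yc w by simp
    ultimately show "w \<in> (\<lambda>v. ?S *\<^sub>v v) ` carrier_vec n" by (metis imageI)
  qed (use S(1) in auto)
  note forms = herm_form_inv_sqrt[OF Y Xc(1)]
  show ?max
    unfolding lambda_max_le_iff[OF M M_herm n]
    \<comment> \<open>Only the quantifier on the right-hand side is rewritten as ranging over the
      image of \<open>inv_sqrt Y\<close>.\<close>
    by (subst (2) surj) (simp add: forms)
  show ?min
    unfolding le_lambda_min_iff[OF M M_herm n]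
    by (subst (2) surj) (simp add: forms)
qed

section \<open>The positive definite cone and the feasible set\<close>

lemma pos_def_mats_add:
  assumes X: "X \<in> pos_def_mats n" and Y: "Y \<in> pos_def_mats n"
  shows "X + Y \<in> pos_def_mats n"
proof -
  have c: "X \<in> carrier_mat n n" "Y \<in> carrier_mat n n"
    using X Y by (auto simp: pos_def_mats_def)
  have "hermitian_mat (X + Y)"
    using X Y mat_adjoint_add[OF c] by (simp add: pos_def_mats_def hermitian_mat_def)
  moreover have "herm_form (X + Y) v > 0" if "v \<in> carrier_vec n" "v \<noteq> 0\<^sub>v n" for v
    unfolding herm_form_add[OF c that(1)]
    using X Y that by (intro add_pos_pos) (auto simp: pos_def_mats_def)
  ultimately show ?thesis using c by (simp add: pos_def_mats_def)
qed

lemma pos_def_mats_smult: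
  assumes X: "X \<in> pos_def_mats n" and r: "r > 0"
  shows "complex_of_real r \<cdot>\<^sub>m X \<in> pos_def_mats n"
proof -
  have c: "X \<in> carrier_mat n n" using X by (auto simp: pos_def_mats_def)
  have "hermitian_mat (complex_of_real r \<cdot>\<^sub>m X)"
    using X mat_adjoint_smult[of "complex_of_real r" X] by (simp add: pos_def_mats_def hermitian_mat_def)
  moreover have "herm_form (complex_of_real r \<cdot>\<^sub>m X) v > 0" if "v \<in> carrier_vec n" "v \<noteq> 0\<^sub>v n" for v
    unfolding herm_form_smult[OF c that(1)]
    using X r that by (intro mult_pos_pos) (auto simp: pos_def_mats_def)
  ultimately show ?thesis using c by (simp add: pos_def_mats_def)
qed

text \<open>Each Loewner constraint and the matching eigenvalue bound unfold to the same inequality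
  between the forms of \<open>X\<close> and \<open>Y i\<close>.\<close>

lemma feasible_iff_lambda:
  assumes n: "n > 0" and Y: "\<And>i. i \<in> {1..N} \<Longrightarrow> Y i \<in> pos_def_mats n"
  shows "feasible n N Y (X, t) \<longleftrightarrow> X \<in> pos_def_mats n \<and>
    (\<forall>i \<in> {1..N}. exp (- t) \<le> lambda_min (inv_sqrt (Y i) * X * inv_sqrt (Y i)) \<and>
      lambda_max (inv_sqrt (Y i) * X * inv_sqrt (Y i)) \<le> exp t)"
proof (cases "X \<in> pos_def_mats n")
  case X: True
  have "loewner_le n (complex_of_real (exp (- t)) \<cdot>\<^sub>m Y i) X \<longleftrightarrow>
      exp (- t) \<le> lambda_min (inv_sqrt (Y i) * X * inv_sqrt (Y i))" (is ?A)
    and "loewner_le n X (complex_of_real (exp t) \<cdot>\<^sub>m Y i) \<longleftrightarrow>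
      lambda_max (inv_sqrt (Y i) * X * inv_sqrt (Y i)) \<le> exp t" (is ?B)
    if i: "i \<in> {1..N}" for i
  proof -
    note Yi = Y[OF i]
    have c: "complex_of_real (exp s) \<cdot>\<^sub>m Y i \<in> carrier_mat n n"
      "hermitian_mat (complex_of_real (exp s) \<cdot>\<^sub>m Y i)" for s
      using pos_def_mats_smult[OF Yi, of "exp s"] by (auto simp: pos_def_mats_def)
    have XY: "X \<in> carrier_mat n n" "hermitian_mat X" "Y i \<in> carrier_mat n n"
      using X Yi by (auto simp: pos_def_mats_def)
    show ?A
      unfolding lambda_inv_sqrt_iff(2)[OF Yi X n] loewner_le_iff[OF c XY(1,2)]
      using herm_form_smult[OF XY(3)] by metis
    show ?B
      unfolding lambda_inv_sqrt_iff(1)[OF Yi X n] loewner_le_iff[OF XY(1,2) c]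
      using herm_form_smult[OF XY(3)] by metis
  qed
  then show ?thesis using X by (auto simp: feasible_def)
qed (auto simp: feasible_def)

text \<open>The bounds are only needed for one \<open>s > 0\<close>; asking for them eventually as \<open>s\<close> tends to
  \<open>0\<close> lets the finitely many constraints be treated one at a time.\<close>

lemma solution_no_improvement:
  assumes n: "n > 0" and Y: "\<And>i. i \<in> {1..N} \<Longrightarrow> Y i \<in> pos_def_mats n"
    and sol: "is_solution n N Y (X, t)"
    and Z: "\<And>s. 0 < s \<Longrightarrow> s < 1 \<Longrightarrow> Z s \<in> pos_def_mats n"
    and bounds: "\<And>i. i \<in> {1..N} \<Longrightarrow> \<forall>\<^sub>F s in at_right (0 :: real). \<exists>a b. exp (- t) < a \<and> b < exp t \<and>
      (\<forall>v \<in> carrier_vec n. a * herm_form (Y i) v \<le> herm_form (Z s) v \<and>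
        herm_form (Z s) v \<le> b * herm_form (Y i) v)"
  shows False
proof -
  let ?P = "\<lambda>s i. \<exists>a b. exp (- t) < a \<and> b < exp t \<and>
      (\<forall>v \<in> carrier_vec n. a * herm_form (Y i) v \<le> herm_form (Z s) v \<and>
        herm_form (Z s) v \<le> b * herm_form (Y i) v)"
  have "\<forall>\<^sub>F s in at_right 0. \<forall>i \<in> {1..N}. ?P s i"
    by (rule eventually_ball_finite) (use bounds in auto)
  moreover have "\<forall>\<^sub>F s in at_right (0 :: real). 0 < s \<and> s < 1"
    by (rule eventually_at_rightI[of 0 1]) auto
  ultimately have "\<forall>\<^sub>F s in at_right 0. (\<forall>i \<in> {1..N}. ?P s i) \<and> 0 < s \<and> s < 1"
    by (rule eventually_conj)
  then obtain s where s: "\<forall>i \<in> {1..N}. ?P s i" "0 < s" "s < 1"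
    using eventually_happens'[OF trivial_limit_at_right_real] by blast
  note W = Z[OF s(2,3)]
  let ?M = "\<lambda>i. inv_sqrt (Y i) * Z s * inv_sqrt (Y i)"
  \<comment> \<open>With \<open>s\<close> fixed, the gaps between \<open>a\<close> and
    \<open>exp (- t)\<close> and between \<open>b\<close> and \<open>exp t\<close> are strict, so by
    continuity they survive replacing \<open>t\<close> by a slightly smaller
    \<open>u\<close>.\<close>
  have "\<forall>\<^sub>F u in at_left t. exp (- u) \<le> lambda_min (?M i) \<and> lambda_max (?M i) \<le> exp u"
    if i: "i \<in> {1..N}" for i
  proof -
    obtain a b where a: "exp (- t) < a" and b: "b < exp t"
      and ab: "\<forall>v \<in> carrier_vec n. a * herm_form (Y i) v \<le> herm_form (Z s) v \<and>
        herm_form (Z s) v \<le> b * herm_form (Y i) v"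
      using s(1) i by metis
    have "((\<lambda>u. exp (- u)) \<longlongrightarrow> exp (- t)) (at_left t)" "(exp \<longlongrightarrow> exp t) (at_left t)"
      by (intro tendsto_intros)+
    from order_tendstoD(2)[OF this(1) a] order_tendstoD(1)[OF this(2) b]
    have "\<forall>\<^sub>F u in at_left t. exp (- u) < a \<and> b < exp u"
      by (rule eventually_conj)
    moreover have "a \<le> lambda_min (?M i)" "lambda_max (?M i) \<le> b"
      using ab lambda_inv_sqrt_iff[OF Y[OF i] W n] by blast+
    ultimately show ?thesis
      by (auto elim!: eventually_mono)
  qed
  then have "\<forall>\<^sub>F u in at_left t. \<forall>i \<in> {1..N}. exp (- u) \<le> lambda_min (?M i) \<and> lambda_max (?M i) \<le> exp u"
    by (intro eventually_ball_finite) auto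
  moreover have "\<forall>\<^sub>F u in at_left t. u < t"
    by (rule eventually_at_leftI[of "t - 1"]) auto
  ultimately have "\<forall>\<^sub>F u in at_left t.
      (\<forall>i \<in> {1..N}. exp (- u) \<le> lambda_min (?M i) \<and> lambda_max (?M i) \<le> exp u) \<and> u < t"
    by (rule eventually_conj)
  then obtain u where u: "\<forall>i \<in> {1..N}. exp (- u) \<le> lambda_min (?M i) \<and> lambda_max (?M i) \<le> exp u" "u < t"
    using eventually_happens'[OF trivial_limit_at_left_real] by blast
  have "feasible n N Y (Z s, u)"
    using W u(1) feasible_iff_lambda[where Y = Y, OF n Y] by simp
  then show False
    using sol u(2) by (auto simp: is_solution_def is_arg_min_def)
qed

lemma herm_form_pos_def_nonneg:
  assumes A: "A \<in> pos_def_mats n" and v: "v \<in> carrier_vec n"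
  shows "herm_form A v \<ge> 0"
proof (cases "v = 0\<^sub>v n")
  case True
  have "A \<in> carrier_mat n n" using A by (simp add: pos_def_mats_def)
  then show ?thesis by (simp add: True)
next
  case False
  then show ?thesis using A v by (auto simp: pos_def_mats_def less_imp_le)
qed

text \<open>In dimension \<open>0\<close> every real \<open>t\<close> is feasible, so the infimum is not attained.\<close>

lemma solution_dimension_pos:
  assumes Y: "\<And>i. i \<in> {1..N} \<Longrightarrow> Y i \<in> pos_def_mats n" and sol: "is_solution n N Y (X, t)"
  shows "n > 0"
proof (rule ccontr)
  assume "\<not> n > 0"
  then have n: "n = 0" by simp
  have feas: "feasible n N Y (X, t)" using sol by (simp add: is_solution_def is_arg_min_def)
  \<comment> \<open>All forms vanish on the zero-dimensional space, so the Loewner order there holds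
    between any two matrices and \<open>t\<close> may be lowered freely.\<close>
  have le: "loewner_le 0 A B" if "A \<in> carrier_mat 0 0" "B \<in> carrier_mat 0 0" for A B
  proof -
    have "hermitian_mat A" "hermitian_mat B"
      using that by (auto simp: hermitian_mat_def mat_eq_iff)
    moreover have "herm_form C v = 0" if "v \<in> carrier_vec 0" for C v
      using that by (simp add: scalar_prod_def)
    ultimately show ?thesis by (simp add: loewner_le_iff[OF that(1) _ that(2)])
  qed
  have X: "X \<in> pos_def_mats 0" using feas n by (simp add: feasible_def)
  have Yc: "Y i \<in> carrier_mat 0 0" if "i \<in> {1..N}" for i
    using Y[OF that] n by (simp add: pos_def_mats_def)
  have Xc: "X \<in> carrier_mat 0 0" using X by (simp add: pos_def_mats_def)
  have "feasible n N Y (X, t - 1)"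
    unfolding feasible_def n using X le[OF _ Xc] le[OF Xc] Yc by simp
  moreover have "\<not> u < t" if "feasible n N Y (X, u)" for u
    using sol that by (auto simp: is_solution_def is_arg_min_def)
  ultimately have "\<not> t - 1 < t" by blast
  then show False by simp
qed

text \<open>This is the claim with the logarithms removed: the two constraints are tight at
  different indices.\<close>

lemma solution_tight_constraints:
  assumes N: "N \<ge> 2" and Y: "\<And>i. i \<in> {1..N} \<Longrightarrow> Y i \<in> pos_def_mats n"
    and sol: "is_solution n N Y (X, t)"
  defines "M \<equiv> \<lambda>i. inv_sqrt (Y i) * X * inv_sqrt (Y i)"
  shows "\<exists>i \<in> {1..N}. \<exists>j \<in> {1..N}. i \<noteq> j \<and>
    lambda_max (M i) = exp t \<and> lambda_min (M j) = exp (- t)"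
proof (rule ccontr)
  assume no_pair: "\<not> ?thesis"
  define a where "a i = lambda_max (M i)" for i
  define b where "b i = lambda_min (M i)" for i
  have n: "n > 0" by (rule solution_dimension_pos[OF Y sol])
  have feas: "feasible n N Y (X, t)" using sol by (simp add: is_solution_def is_arg_min_def)
  have feas': "X \<in> pos_def_mats n \<and>
    (\<forall>i \<in> {1..N}. exp (- t) \<le> lambda_min (M i) \<and> lambda_max (M i) \<le> exp t)"
    unfolding M_def by (rule iffD1[OF feasible_iff_lambda feas]) (use n Y in simp_all)
  have X: "X \<in> pos_def_mats n" using feas' by blast
  have Xc: "X \<in> carrier_mat n n" using X by (simp add: pos_def_mats_def)
  have b_ge: "exp (- t) \<le> b i" and a_le: "a i \<le> exp t" if "i \<in> {1..N}" for i
    using feas' that unfolding a_def b_def by blast+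
  have b0: "b i > 0" if "i \<in> {1..N}" for i
    using b_ge[OF that] by (rule less_le_trans[OF exp_gt_zero])
  have up: "herm_form X v \<le> a i * herm_form (Y i) v"
    and lo: "b i * herm_form (Y i) v \<le> herm_form X v" if "i \<in> {1..N}" "v \<in> carrier_vec n" for i v
    using lambda_inv_sqrt_iff[OF Y[OF that(1)] X n] that(2) unfolding a_def b_def M_def by blast+
  have Y0: "herm_form (Y i) v \<ge> 0" if "i \<in> {1..N}" "v \<in> carrier_vec n" for i v
    by (rule herm_form_pos_def_nonneg[OF Y[OF that(1)] that(2)])
  \<comment> \<open>Both comparison constants are tested at one nonzero vector, where the form of
    \<open>Y i\<close> is positive; \<open>n > 0\<close> provides the unit vector.\<close>
  have ba: "b i \<le> a i" if i: "i \<in> {1..N}" for i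
  proof -
    have u: "unit_vec n 0 \<in> carrier_vec n" "(unit_vec n 0 :: complex vec) \<noteq> 0\<^sub>v n"
      using n by auto
    then have "herm_form (Y i) (unit_vec n 0) > 0" using Y[OF i] by (simp add: pos_def_mats_def)
    moreover have "b i * herm_form (Y i) (unit_vec n 0) \<le> a i * herm_form (Y i) (unit_vec n 0)"
      using lo[OF i u(1)] up[OF i u(1)] by linarith
    ultimately show ?thesis by simp
  qed
  have no_pair': "i = j" if "i \<in> {1..N}" "j \<in> {1..N}" "a i = exp t" "b j = exp (- t)" for i j
    using no_pair that unfolding a_def b_def by blast
  \<comment> \<open>Otherwise \<open>exp t \<le> exp (- t) \<le> b i \<le> a i \<le> exp t\<close>,
    so all are equal for every index, and the distinct indices 1 and 2 form a forbidden
    pair.\<close>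
  have t: "t > 0"
  proof (rule ccontr)
    assume "\<not> t > 0"
    then have "exp t \<le> exp (- t)" by simp
    then have "a i = exp t \<and> b i = exp (- t)" if "i \<in> {1..N}" for i
      using a_le[OF that] b_ge[OF that] ba[OF that] by linarith
    then have "(1 :: nat) = 2" using no_pair'[of 1 2] N by simp
    then show False by simp
  qed
  have smult_form: "herm_form (complex_of_real c \<cdot>\<^sub>m X) v = c * herm_form X v"
    if "v \<in> carrier_vec n" for c v by (rule herm_form_smult[OF Xc that])
  have at_right_pos: "\<forall>\<^sub>F s in at_right (0 :: real). 0 < s \<and> s < 1"
    by (rule eventually_at_rightI[of 0 1]) auto
  \<comment> \<open>If both ends are attained, \<open>no_pair'\<close> forces the index attaining
    the upper end to equal the one attaining the lower end.\<close>
  consider (upper) "\<And>i. i \<in> {1..N} \<Longrightarrow> a i \<noteq> exp t"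
    | (lower) "\<And>i. i \<in> {1..N} \<Longrightarrow> b i \<noteq> exp (- t)"
    | (same) i where "i \<in> {1..N}" "a i = exp t" "b i = exp (- t)"
    using no_pair' by metis
  then show False
  proof cases
    case upper
    \<comment> \<open>Scaling up makes every lower bound strict because \<open>b i > 0\<close>,
      while the upper bounds are already strict and stay so for small \<open>s\<close>.\<close>
    let ?Z = "\<lambda>s. complex_of_real (1 + s) \<cdot>\<^sub>m X"
    show False
    proof (rule solution_no_improvement[where Z = ?Z, OF n Y sol])
      fix s :: real assume "0 < s" then show "?Z s \<in> pos_def_mats n"
        by (intro pos_def_mats_smult[OF X]) simp
    next
      fix i assume i: "i \<in> {1..N}"
      have "((\<lambda>s. (1 + s) * a i) \<longlongrightarrow> (1 + 0) * a i) (at_right 0)" by (intro tendsto_intros)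
      moreover have "(1 + 0) * a i < exp t" using a_le[OF i] upper[OF i] by simp
      ultimately have "\<forall>\<^sub>F s in at_right 0. (1 + s) * a i < exp t" by (rule order_tendstoD(2))
      with at_right_pos
      show "\<forall>\<^sub>F s in at_right (0 :: real). \<exists>p q. exp (- t) < p \<and> q < exp t \<and>
        (\<forall>v \<in> carrier_vec n. p * herm_form (Y i) v \<le> herm_form (?Z s) v \<and>
          herm_form (?Z s) v \<le> q * herm_form (Y i) v)"
      proof (rule eventually_elim2)
        fix s :: real assume s: "0 < s \<and> s < 1" and q: "(1 + s) * a i < exp t"
        have "1 * b i < (1 + s) * b i" using s b0[OF i] by (intro mult_strict_right_mono) auto
        then have "exp (- t) < (1 + s) * b i" using b_ge[OF i] by linarith
        moreover have "(1 + s) * b i * herm_form (Y i) v \<le> herm_form (?Z s) v"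
          "herm_form (?Z s) v \<le> (1 + s) * a i * herm_form (Y i) v" if v: "v \<in> carrier_vec n" for v
          unfolding smult_form[OF v] mult.assoc
          using lo[OF i v] up[OF i v] s by (auto intro!: mult_left_mono)
        ultimately show "\<exists>p q. exp (- t) < p \<and> q < exp t \<and>
          (\<forall>v \<in> carrier_vec n. p * herm_form (Y i) v \<le> herm_form (?Z s) v \<and>
            herm_form (?Z s) v \<le> q * herm_form (Y i) v)"
          using q by blast
      qed
    qed
  next
    case lower
    \<comment> \<open>The mirror image: scaling down makes the upper bounds strict, since
      \<open>a i \<ge> b i > 0\<close>, and small \<open>s\<close> preserves the strict lower
      bounds.\<close>
    let ?Z = "\<lambda>s. complex_of_real (1 - s) \<cdot>\<^sub>m X"
    show False
    proof (rule solution_no_improvement[where Z = ?Z, OF n Y sol])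
      fix s :: real assume "s < 1" then show "?Z s \<in> pos_def_mats n"
        by (intro pos_def_mats_smult[OF X]) simp
    next
      fix i assume i: "i \<in> {1..N}"
      have "((\<lambda>s. (1 - s) * b i) \<longlongrightarrow> (1 - 0) * b i) (at_right 0)" by (intro tendsto_intros)
      moreover have "exp (- t) < (1 - 0) * b i" using b_ge[OF i] lower[OF i] by simp
      ultimately have "\<forall>\<^sub>F s in at_right 0. exp (- t) < (1 - s) * b i" by (rule order_tendstoD(1))
      with at_right_pos
      show "\<forall>\<^sub>F s in at_right (0 :: real). \<exists>p q. exp (- t) < p \<and> q < exp t \<and>
        (\<forall>v \<in> carrier_vec n. p * herm_form (Y i) v \<le> herm_form (?Z s) v \<and>
          herm_form (?Z s) v \<le> q * herm_form (Y i) v)"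
      proof (rule eventually_elim2)
        fix s :: real assume s: "0 < s \<and> s < 1" and p: "exp (- t) < (1 - s) * b i"
        have "(1 - s) * a i < 1 * a i" using s b0[OF i] ba[OF i] by (intro mult_strict_right_mono) auto
        then have "(1 - s) * a i < exp t" using a_le[OF i] by linarith
        moreover have "(1 - s) * b i * herm_form (Y i) v \<le> herm_form (?Z s) v"
          "herm_form (?Z s) v \<le> (1 - s) * a i * herm_form (Y i) v" if v: "v \<in> carrier_vec n" for v
          unfolding smult_form[OF v] mult.assoc
          using lo[OF i v] up[OF i v] s by (auto intro!: mult_left_mono)
        ultimately show "\<exists>p q. exp (- t) < p \<and> q < exp t \<and>
          (\<forall>v \<in> carrier_vec n. p * herm_form (Y i) v \<le> herm_form (?Z s) v \<and>
            herm_form (?Z s) v \<le> q * herm_form (Y i) v)"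
          using p by blast
      qed
    qed
  next
    case (same k)
    note k = same(1)
    \<comment> \<open>Relative to \<open>Y k\<close> itself, moving towards \<open>Y k\<close> pulls
      both constants \<open>a k\<close> and \<open>b k\<close> towards 1, which lies strictly
      between \<open>exp (- t)\<close> and \<open>exp t\<close>.\<close>
    let ?Z = "\<lambda>s. complex_of_real (1 - s) \<cdot>\<^sub>m X + complex_of_real s \<cdot>\<^sub>m Y k"
    have Yk: "Y k \<in> carrier_mat n n" using Y[OF k] by (simp add: pos_def_mats_def)
    have Z_form: "herm_form (?Z s) v = (1 - s) * herm_form X v + s * herm_form (Y k) v"
      if v: "v \<in> carrier_vec n" for s v
    proof -
      have "complex_of_real (1 - s) \<cdot>\<^sub>m X \<in> carrier_mat n n" "complex_of_real s \<cdot>\<^sub>m Y k \<in> carrier_mat n n"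
        using Xc Yk by simp_all
      from herm_form_add[OF this v] show ?thesis
        unfolding smult_form[OF v] herm_form_smult[OF Yk v] .
    qed
    show False
    proof (rule solution_no_improvement[where Z = ?Z, OF n Y sol])
      fix s :: real assume "0 < s" "s < 1" then show "?Z s \<in> pos_def_mats n"
        by (intro pos_def_mats_add pos_def_mats_smult X Y[OF k]) simp_all
    next
      fix i assume i: "i \<in> {1..N}"
      show "\<forall>\<^sub>F s in at_right (0 :: real). \<exists>p q. exp (- t) < p \<and> q < exp t \<and>
        (\<forall>v \<in> carrier_vec n. p * herm_form (Y i) v \<le> herm_form (?Z s) v \<and>
          herm_form (?Z s) v \<le> q * herm_form (Y i) v)"
      proof (cases "i = k")
        case True
        show ?thesis
        proof (rule eventually_mono[OF at_right_pos])
          fix s :: real assume s: "0 < s \<and> s < 1"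
          have "s * exp (- t) < s * 1" "s * 1 < s * exp t"
            using s t by (intro mult_strict_left_mono; simp)+
          then have "exp (- t) < (1 - s) * b k + s" "(1 - s) * a k + s < exp t"
            unfolding same by (simp_all add: algebra_simps)
          moreover have "((1 - s) * b k + s) * herm_form (Y i) v \<le> herm_form (?Z s) v"
            "herm_form (?Z s) v \<le> ((1 - s) * a k + s) * herm_form (Y i) v"
            if v: "v \<in> carrier_vec n" for v
            unfolding Z_form[OF v] True distrib_right mult.assoc
            using lo[OF k v] up[OF k v] s by (auto intro!: mult_left_mono)
          ultimately show "\<exists>p q. exp (- t) < p \<and> q < exp t \<and>
            (\<forall>v \<in> carrier_vec n. p * herm_form (Y i) v \<le> herm_form (?Z s) v \<and>
              herm_form (?Z s) v \<le> q * herm_form (Y i) v)"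
            by blast
        qed
      next
        case False
        \<comment> \<open>Index \<open>k\<close> attains both ends, so any other index attaining
          either end would form a forbidden pair with \<open>k\<close>. Both bounds at
          \<open>i\<close> thus have slack.\<close>
        have "a i \<noteq> exp t" "b i \<noteq> exp (- t)"
          using no_pair'[OF i k _ same(3)] no_pair'[OF k i same(2)] False by blast+
        then have strict: "exp (- t) < b i" "a i < exp t" using a_le[OF i] b_ge[OF i] by simp_all
        have "((\<lambda>s. (1 - s) * b i) \<longlongrightarrow> (1 - 0) * b i) (at_right 0)" by (intro tendsto_intros)
        moreover have "exp (- t) < (1 - 0) * b i" using strict by simp
        ultimately have p: "\<forall>\<^sub>F s in at_right 0. exp (- t) < (1 - s) * b i" by (rule order_tendstoD(1))
        \<comment> \<open>The constant \<open>s / b k\<close> arises from bounding the added term by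
          \<open>X\<close>: the form of \<open>Y k\<close> is at most that of \<open>X\<close>
          divided by \<open>b k\<close>. For the lower bound the added term is nonnegative and is
          dropped.\<close>
        have "((\<lambda>s. (1 - s + s / b k) * a i) \<longlongrightarrow> (1 - 0 + 0 / b k) * a i) (at_right 0)"
          using b0[OF k] by (intro tendsto_intros) simp
        moreover have "(1 - 0 + 0 / b k) * a i < exp t" using strict by simp
        ultimately have q: "\<forall>\<^sub>F s in at_right 0. (1 - s + s / b k) * a i < exp t"
          by (rule order_tendstoD(2))
        show ?thesis
        proof (rule eventually_mono[OF eventually_conj[OF at_right_pos eventually_conj[OF p q]]])
          fix s :: real
          assume "(0 < s \<and> s < 1) \<and> exp (- t) < (1 - s) * b i \<and> (1 - s + s / b k) * a i < exp t"
          then have s: "0 < s" "s < 1"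
            and pq: "exp (- t) < (1 - s) * b i" "(1 - s + s / b k) * a i < exp t" by auto
          have "(1 - s) * b i * herm_form (Y i) v \<le> herm_form (?Z s) v"
            "herm_form (?Z s) v \<le> (1 - s + s / b k) * a i * herm_form (Y i) v"
            if v: "v \<in> carrier_vec n" for v
          proof -
            have "(1 - s) * (b i * herm_form (Y i) v) \<le> (1 - s) * herm_form X v"
              using lo[OF i v] s by (intro mult_left_mono) auto
            moreover have "0 \<le> s * herm_form (Y k) v" using Y0[OF k v] s by simp
            ultimately show "(1 - s) * b i * herm_form (Y i) v \<le> herm_form (?Z s) v"
              unfolding Z_form[OF v] mult.assoc by linarith
            have "herm_form (Y k) v \<le> herm_form X v / b k"
              using lo[OF k v] b0[OF k] by (simp add: pos_le_divide_eq mult.commute)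
            then have "s * herm_form (Y k) v \<le> s * (herm_form X v / b k)"
              using s by (intro mult_left_mono) auto
            then have "herm_form (?Z s) v \<le> (1 - s + s / b k) * herm_form X v"
              unfolding Z_form[OF v] distrib_right by simp
            also have "\<dots> \<le> (1 - s + s / b k) * (a i * herm_form (Y i) v)"
              using up[OF i v] s b0[OF k] by (intro mult_left_mono) auto
            finally show "herm_form (?Z s) v \<le> (1 - s + s / b k) * a i * herm_form (Y i) v"
              by (simp only: mult.assoc)
          qed
          then show "\<exists>p q. exp (- t) < p \<and> q < exp t \<and>
            (\<forall>v \<in> carrier_vec n. p * herm_form (Y i) v \<le> herm_form (?Z s) v \<and>
              herm_form (?Z s) v \<le> q * herm_form (Y i) v)"
            using pq by blast
        qed
      qed
    qed
  qed
qed

theorem proposition3p10: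
  fixes n N :: nat and Y :: "nat \<Rightarrow> complex mat" and X :: "complex mat" and t :: real
  assumes "N \<ge> 2"
    and "\<And>i. i \<in> {1..N} \<Longrightarrow> Y i \<in> pos_def_mats n"
    and "is_solution n N Y (X, t)"
  shows "\<exists>i \<in> {1..N}. \<exists>j \<in> {1..N}. i \<noteq> j \<and>
    ln (lambda_max (inv_sqrt (Y i) * X * inv_sqrt (Y i))) = t \<and>
    - ln (lambda_min (inv_sqrt (Y j) * X * inv_sqrt (Y j))) = t"
proof -
  obtain i j where ij: "i \<in> {1..N}" "j \<in> {1..N}" "i \<noteq> j"
    and max: "lambda_max (inv_sqrt (Y i) * X * inv_sqrt (Y i)) = exp t"
    and min: "lambda_min (inv_sqrt (Y j) * X * inv_sqrt (Y j)) = exp (- t)"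
    using solution_tight_constraints[OF assms] by blast
  have "ln (lambda_max (inv_sqrt (Y i) * X * inv_sqrt (Y i))) = t"
    "- ln (lambda_min (inv_sqrt (Y j) * X * inv_sqrt (Y j))) = t"
    unfolding max min by simp_all
  then show ?thesis using ij by blast
qed

end
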